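(* Let $F$ be a field of characteristic $p>0$, $\lambda\ge 0$ an integer, and $A_1,\dots,A_n$ $\lambda$-Vandermonde finite subsets of $F$ such that $p$ divides each of $|A_1|,\dots,|A_n|$. Let $f\in F[X_1,\dots,X_n]$ be a polynomial with $\deg(f)<n(\lambda+1)$. Then \[\sum_{a\in A_1\times\dots\times A_n}f(a)=0.\]
   Context: A finite non-empty subset $A\subseteq F$ is $\lambda$-Vandermonde (for $\lambda\in\{0,\dots,|A|\}$) if $\sum_{a\in A}a^r=0$ for all $1\le r\le\lambda$. $\deg(f)$ is the total degree. *)

theory Defs
  imports
    "HOL-Computational_Algebra.Computational_Algebra"
    "HOL-Library.Poly_Mapping"
    "HOL-Library.FuncSet"
begin

(* Polynomials in variables X_0, X_1, ...: finitely supported maps from monomials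
   (finitely supported exponent functions) to coefficients. Multiplication on poly_mapping is
   convolution, so this type is the polynomial ring; F[X_1,...,X_n] is the set of f with
   mpoly_vars f a subset of {1..n}. *)
type_synonym 'a mpoly = "(nat \<Rightarrow>\<^sub>0 nat) \<Rightarrow>\<^sub>0 'a"

definition mpoly_vars :: "'a::zero mpoly \<Rightarrow> nat set" where
  "mpoly_vars f = (\<Union>m\<in>Poly_Mapping.keys f. Poly_Mapping.keys m)"

definition monom_degree :: "(nat \<Rightarrow>\<^sub>0 nat) \<Rightarrow> nat" where
  "monom_degree m = (\<Sum>i\<in>Poly_Mapping.keys m. Poly_Mapping.lookup m i)"

(* The zero polynomial gets degree 0. *)
definition total_degree :: "'a::zero mpoly \<Rightarrow> nat" where
  "total_degree f = Max (insert 0 (monom_degree ` Poly_Mapping.keys f))"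

definition mpoly_eval :: "'a::comm_semiring_1 mpoly \<Rightarrow> (nat \<Rightarrow> 'a) \<Rightarrow> 'a" where
  "mpoly_eval f x = (\<Sum>m\<in>Poly_Mapping.keys f.
     Poly_Mapping.lookup f m * (\<Prod>i\<in>Poly_Mapping.keys m. x i ^ Poly_Mapping.lookup m i))"

definition vandermonde :: "nat \<Rightarrow> 'a::field set \<Rightarrow> bool" where
  "vandermonde l A \<longleftrightarrow>
     finite A \<and> A \<noteq> {} \<and> l \<le> card A \<and> (\<forall>r\<in>{1..l}. (\<Sum>a\<in>A. a ^ r) = 0)"

end

theory Submission
  imports Defs
begin

text \<open>Expand \<open>f\<close> into monomials. The sum of a monomial over the grid is the product over \<open>i\<close> of the
  power sums of \<open>A\<^sub>i\<close>. As the degree is less than \<open>n(\<lambda> + 1)\<close>, some exponent is at most \<open>\<lambda>\<close>, and the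
  corresponding power sum vanishes: by the Vandermonde condition if the exponent is positive, and
  because \<open>p\<close> divides \<open>|A\<^sub>i|\<close> if it is \<open>0\<close>.\<close>

lemma vandermonde_power_sum_eq_0:
  fixes A :: "'a::field set"
  assumes "vandermonde l A" and "CHAR('a) dvd card A" and "r \<le> l"
  shows "(\<Sum>a\<in>A. a ^ r) = 0"
proof (cases "r = 0")
  case True
  \<comment> \<open>Since \<open>0 ^ 0 = 1\<close>, every element of \<open>A\<close>, including 0,
    contributes 1, so the sum is \<open>of_nat (card A)\<close>.\<close>
  with assms(2) show ?thesis by (simp add: of_nat_eq_0_iff_char_dvd)
next
  case False
  with assms(1,3) show ?thesis by (simp add: vandermonde_def)
qed

lemma monom_degree_eq_sum:
  assumes "finite S" and "Poly_Mapping.keys m \<subseteq> S"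
  shows "monom_degree m = (\<Sum>i\<in>S. Poly_Mapping.lookup m i)"
  unfolding monom_degree_def using assms
  by (intro sum.mono_neutral_left) (auto simp: in_keys_iff)

lemma monom_degree_le_total_degree:
  "m \<in> Poly_Mapping.keys f \<Longrightarrow> monom_degree m \<le> total_degree f"
  unfolding total_degree_def by (intro Max_ge) auto

text \<open>Distributivity, once the monomial is padded with factors \<open>a i ^ 0 = 1\<close> to
  range over all of \<open>S\<close>. A variable absent from \<open>m\<close> thus contributes the
  factor \<open>of_nat (card (A i))\<close>, not 1.\<close>

lemma sum_PiE_monomial:
  fixes A :: "nat \<Rightarrow> 'a::comm_semiring_1 set"
  assumes "finite S" and "Poly_Mapping.keys m \<subseteq> S" and "\<And>i. i \<in> S \<Longrightarrow> finite (A i)"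
  shows "(\<Sum>a\<in>Pi\<^sub>E S A. \<Prod>i\<in>Poly_Mapping.keys m. a i ^ Poly_Mapping.lookup m i) =
    (\<Prod>i\<in>S. \<Sum>x\<in>A i. x ^ Poly_Mapping.lookup m i)"
proof -
  have "(\<Prod>i\<in>Poly_Mapping.keys m. a i ^ Poly_Mapping.lookup m i) =
      (\<Prod>i\<in>S. a i ^ Poly_Mapping.lookup m i)" for a :: "nat \<Rightarrow> 'a"
    using assms(1,2) by (intro prod.mono_neutral_left) (auto simp: in_keys_iff)
  with assms(1,3) show ?thesis by (simp add: prod_sum_PiE)
qed

theorem theorem5p5:
  fixes p n l :: nat
    and A :: "nat \<Rightarrow> 'a::field set"
    and f :: "'a mpoly"
  assumes "CHAR('a) = p" and "p > 0"
    and "\<And>i. i \<in> {1..n} \<Longrightarrow> vandermonde l (A i)"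
    and "\<And>i. i \<in> {1..n} \<Longrightarrow> p dvd card (A i)"
    and "mpoly_vars f \<subseteq> {1..n}"
    and "total_degree f < n * (l + 1)"
  shows "(\<Sum>a\<in>(\<Pi>\<^sub>E i\<in>{1..n}. A i). mpoly_eval f a) = 0"
proof -
  have monomial: "(\<Sum>a\<in>Pi\<^sub>E {1..n} A. \<Prod>i\<in>Poly_Mapping.keys m. a i ^ Poly_Mapping.lookup m i) = 0"
    if m: "m \<in> Poly_Mapping.keys f" for m
  proof -
    have vars: "Poly_Mapping.keys m \<subseteq> {1..n}"
      using assms(5) m by (auto simp: mpoly_vars_def)
    have "\<exists>i\<in>{1..n}. Poly_Mapping.lookup m i \<le> l"
    proof (rule ccontr)
      assume "\<not> ?thesis"
      \<comment> \<open>If all \<open>n\<close> exponents were at least \<open>l + 1\<close>, the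
        degree would reach \<open>n * (l + 1)\<close>, against the strict bound on
        \<open>total_degree f\<close>.\<close>
      then have "(\<Sum>i\<in>{1..n}. l + 1) \<le> (\<Sum>i\<in>{1..n}. Poly_Mapping.lookup m i)"
        by (intro sum_mono) (auto simp: not_le Suc_le_eq)
      also have "\<dots> \<le> total_degree f"
        using monom_degree_le_total_degree[OF m] monom_degree_eq_sum[OF _ vars] by simp
      finally show False using assms(6) by simp
    qed
    then obtain i where i: "i \<in> {1..n}" "Poly_Mapping.lookup m i \<le> l" by blast
    then have "(\<Sum>x\<in>A i. x ^ Poly_Mapping.lookup m i) = 0"
      using assms(1,3,4) by (intro vandermonde_power_sum_eq_0) auto
    with i(1) have "(\<Prod>i\<in>{1..n}. \<Sum>x\<in>A i. x ^ Poly_Mapping.lookup m i) = 0"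
      by (intro prod_zero) auto
    moreover have "finite (A i)" if "i \<in> {1..n}" for i
      using assms(3)[OF that] by (simp add: vandermonde_def)
    ultimately show ?thesis
      using sum_PiE_monomial[OF _ vars, of A] by simp
  qed
  have "(\<Sum>a\<in>Pi\<^sub>E {1..n} A. mpoly_eval f a) = (\<Sum>m\<in>Poly_Mapping.keys f. Poly_Mapping.lookup f m *
      (\<Sum>a\<in>Pi\<^sub>E {1..n} A. \<Prod>i\<in>Poly_Mapping.keys m. a i ^ Poly_Mapping.lookup m i))"
    \<comment> \<open>Moving each coefficient into the inner sum on the right makes both sides the
      same double sum in opposite orders.\<close>
    unfolding mpoly_eval_def sum_distrib_left by (rule sum.swap)
  with monomial show ?thesis by simp
qed

end
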